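(* Let $H$ be a nonzero real symmetric $N\times N$ matrix with spectral radius $\rho(H)$. Consider an $r$-th order splitting method with propagation matrix $K(y)$, stability threshold $y_*$ and associated functions $\phi,\epsilon,\gamma$ on $(-y_*,y_* )$. Given $u_0=q_0+i\,p_0$ with $q_0,p_0\in\mathbb{R}^N$, and $t\in\mathbb{R}^+$, let $n\ge 1$ be an integer such that $\tau=t/n=\theta/\rho(H)$ with $\theta<y_*$, and let $u_n=q_n+i\,p_n$ be the approximation to $u(t)=\mathrm{e}^{-i\,tH}u_0$ obtained by applying $n$ steps of length $\tau$ of the splitting method. Then, for each $k\in[0,r]$, $$ \|u_n-u(t)\|\le\frac{t\,\mu_k(\theta)\,\|u_0\|_{k+1}+\nu_k(\theta)\,\|u_0\|_k}{\rho(H)^k}, $$ where $$ \mu_k(\theta)=\sup_{0\le y\le\theta}\left|\frac{\phi(y)}{y}-1\right|(\theta/y)^k,\qquad \nu_k(\theta)=\sup_{0\le y\le\theta}\|E(y)\|\,(\theta/y)^k, $$ (the expressions inside the suprema being considered for $y\neq0$), and $$ E(y)=\begin{pmatrix}\epsilon(y)&\gamma(y)-1\\[4pt] -\dfrac{1+\epsilon(y)^2}{\gamma(y)}+1&-\epsilon(y)\end{pmatrix}. $$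
   Context: A splitting method with $m$ stages is given by real coefficients $a_1,b_1,\dots,a_m,b_m$. Its propagation matrix is, for $y\in\mathbb{R}$, $$ K(y)=\begin{pmatrix}1&0\\ -b_m y&1\end{pmatrix}\begin{pmatrix}1&a_m y\\ 0&1\end{pmatrix}\cdots\begin{pmatrix}1&0\\ -b_1 y&1\end{pmatrix}\begin{pmatrix}1&a_1 y\\ 0&1\end{pmatrix}=\begin{pmatrix}K_1(y)&K_2(y)\\ K_3(y)&K_4(y)\end{pmatrix}, $$ with $K_1,K_4$ even and $K_2,K_3$ odd real polynomials and $\det K(y)=1$. Applying $n$ steps of length $\tau$ of the method (to the system $\dot q=Hp$, $\dot p=-Hq$, equivalent to $i\dot u=Hu$ with $u=q+ip$) to $u_0=q_0+ip_0$ means setting $$ \begin{pmatrix}q_n\\ p_n\end{pmatrix}=K(\tau H)^n\begin{pmatrix}q_0\\ p_0\end{pmatrix},\qquad K(\tau H)=\begin{pmatrix}K_1(\tau H)&K_2(\tau H)\\ K_3(\tau H)&K_4(\tau H)\end{pmatrix}\in\mathbb{R}^{2N\times2N}, $$ and $u_n=q_n+ip_n$. The matrix $K(y)$ is stable if $\sup_{n\ge1}\|K(y)^n\|<\infty$. The stability threshold $y_*$ is the largest non-negative real number such that $K(y)$ is stable for all $y\in(-y_*,y_* )$. Associated functions: $\phi,\epsilon$ are odd real functions and $\gamma$ is an even, nowhere vanishing real function on $(-y_*,y_* )$ such that for all $y\in(-y_*,y_* )$ $$ K(y)=\begin{pmatrix} \cos(\phi(y))+\epsilon(y)\sin(\phi(y))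 & \gamma(y)\sin(\phi(y)) \\[4pt] -\dfrac{1+\epsilon(y)^2}{\gamma(y)}\sin(\phi(y)) & \cos(\phi(y))-\epsilon(y)\sin(\phi(y)) \end{pmatrix}. $$ The method is of order $r$ (an integer $r\ge0$) if $K(y)=\begin{pmatrix}\cos y&\sin y\\ -\sin y&\cos y\end{pmatrix}+\mathcal{O}(y^{r+1})$ as $y\to0$; for a method of order $r$ the associated functions satisfy $\phi(y)=y+\mathcal{O}(y^{r+1})$, $\epsilon(y)=\mathcal{O}(y^r)$, $\gamma(y)=1+\mathcal{O}(y^r)$ as $y\to0$. For $k\ge0$ and $u\in\mathbb{C}^N$, $\|u\|_k:=\|H^ku\|$, with $\|\cdot\|$ the Euclidean norm; for non-integer $k$ this is understood as $\||H|^ku\|$ with $|H|^k$ defined by the spectral decomposition of $H$ (for integer $k$ the two agree), and $H^0=I$. Matrix norms are the operator norms induced by the Euclidean norm; suprema are taken in $[0,+\infty]$, with the convention $0\cdot\infty=0$. *)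

theory Defs
  imports
    "HOL-Analysis.Analysis"
    "HOL-Computational_Algebra.Polynomial"
    "HOL-Library.Landau_Symbols"
begin

section \<open>Matrices\<close>

definition mat2 :: "'a::zero \<Rightarrow> 'a \<Rightarrow> 'a \<Rightarrow> 'a \<Rightarrow> 'a^2^2" where
  "mat2 p q r s = vector [vector [p, q], vector [r, s]]"

primrec mat_power :: "'a::semiring_1^'n^'n \<Rightarrow> nat \<Rightarrow> 'a^'n^'n" where
  "mat_power A 0 = mat 1"
| "mat_power A (Suc j) = A ** mat_power A j"

definition mat_exp :: "complex^'n^'n \<Rightarrow> complex^'n^'n" where
  "mat_exp A = (\<Sum>j. (1 / fact j) *\<^sub>R mat_power A j)"

definition poly_mat :: "real poly \<Rightarrow> real^'n^'n \<Rightarrow> real^'n^'n" where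
  "poly_mat p A = (\<Sum>j\<le>degree p. coeff p j *\<^sub>R mat_power A j)"

definition block_mat ::
  "'a^'n^'n \<Rightarrow> 'a^'n^'n \<Rightarrow> 'a^'n^'n \<Rightarrow> 'a^'n^'n \<Rightarrow> 'a^('n + 'n)^('n + 'n)" where
  "block_mat A B C D = (\<chi> i j.
     case i of
       Inl i' \<Rightarrow> (case j of Inl j' \<Rightarrow> A $ i' $ j' | Inr j' \<Rightarrow> B $ i' $ j')
     | Inr i' \<Rightarrow> (case j of Inl j' \<Rightarrow> C $ i' $ j' | Inr j' \<Rightarrow> D $ i' $ j'))"

definition block_vec :: "'a^'n \<Rightarrow> 'a^'n \<Rightarrow> 'a^('n + 'n)" where
  "block_vec q p = (\<chi> i. case i of Inl i' \<Rightarrow> q $ i' | Inr i' \<Rightarrow> p $ i')"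

definition upper_part :: "'a^('n + 'n) \<Rightarrow> 'a^'n" where
  "upper_part z = (\<chi> i. z $ Inl i)"

definition lower_part :: "'a^('n + 'n) \<Rightarrow> 'a^'n" where
  "lower_part z = (\<chi> i. z $ Inr i)"

definition cvec :: "real^'n \<Rightarrow> real^'n \<Rightarrow> complex^'n" where
  "cvec q p = (\<chi> i. Complex (q $ i) (p $ i))"

definition cmat :: "real^'n^'n \<Rightarrow> complex^'n^'n" where
  "cmat A = (\<chi> i j. complex_of_real (A $ i $ j))"

abbreviation op_norm :: "real^'n^'m \<Rightarrow> real" where
  "op_norm A \<equiv> onorm ((*v) A)"


section \<open>Spectrum and graph norms\<close>

definition eigenspace :: "complex^'n^'n \<Rightarrow> complex \<Rightarrow> (complex^'n) set" where
  "eigenspace A z = {v. A *v v = z *s v}"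

definition eigenvalues :: "complex^'n^'n \<Rightarrow> complex set" where
  "eigenvalues A = {z. \<exists>v. v \<noteq> 0 \<and> A *v v = z *s v}"

definition spectral_radius :: "real^'n^'n \<Rightarrow> real" where
  "spectral_radius A = Max (cmod ` eigenvalues (cmat A))"

text \<open>
  For real symmetric \<open>H\<close> the spectral decomposition writes \<open>H\<close> as the sum of
  \<open>z\<close> times the orthogonal projection onto the eigenspace of \<open>z\<close>, over the eigenvalues \<open>z\<close>.
  The closest point of an eigenspace is that orthogonal projection: the real inner product
  on complex vectors is the real part of the Hermitian one, and on complex subspaces
  both have the same orthogonal projection. Only \<open>s > 0\<close> is meant here, so that
  \<open>0 powr s = 0\<close> is the intended value on the kernel.
\<close>

definition abs_powr_apply :: "real^'n^'n \<Rightarrow> real \<Rightarrow> complex^'n \<Rightarrow> complex^'n" where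
  "abs_powr_apply H s u =
     (\<Sum>z\<in>eigenvalues (cmat H). (cmod z powr s) *\<^sub>R closest_point (eigenspace (cmat H) z) u)"

definition norm_H :: "real^'n^'n \<Rightarrow> real \<Rightarrow> complex^'n \<Rightarrow> real" where
  "norm_H H s u =
     (if s \<in> \<nat> then norm (mat_power (cmat H) (nat \<lfloor>s\<rfloor>) *v u) else norm (abs_powr_apply H s u))"


section \<open>Splitting methods\<close>

text \<open>
  The coefficients are \<open>a 1, b 1, \<dots>, a m, b m\<close>; the values of \<open>a\<close> and \<open>b\<close> at other indices are
  irrelevant. The product is defined over an arbitrary commutative ring in order to
  have both the real matrix \<open>K(y)\<close> and the matrix of its polynomial entries.
\<close>

primrec stage_product ::
  "(nat \<Rightarrow> 'a::comm_ring_1) \<Rightarrow> (nat \<Rightarrow> 'a) \<Rightarrow> nat \<Rightarrow> 'a \<Rightarrow> 'a^2^2" where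
  "stage_product a b 0 y = mat 1"
| "stage_product a b (Suc j) y =
     mat2 1 0 (- b (Suc j) * y) 1 ** mat2 1 (a (Suc j) * y) 0 1 ** stage_product a b j y"

definition prop_matrix :: "(nat \<Rightarrow> real) \<Rightarrow> (nat \<Rightarrow> real) \<Rightarrow> nat \<Rightarrow> real \<Rightarrow> real^2^2" where
  "prop_matrix a b m y = stage_product a b m y"

definition prop_poly :: "(nat \<Rightarrow> real) \<Rightarrow> (nat \<Rightarrow> real) \<Rightarrow> nat \<Rightarrow> (real poly)^2^2" where
  "prop_poly a b m = stage_product (\<lambda>j. [:a j:]) (\<lambda>j. [:b j:]) m [:0, 1:]"

lemma poly_prop_poly: "poly (prop_poly a b m $ i $ j) y = prop_matrix a b m y $ i $ j"
proof -
  have "\<forall>i j. poly (prop_poly a b m $ i $ j) y = prop_matrix a b m y $ i $ j"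
    unfolding prop_poly_def prop_matrix_def
    by (induction m)
      (simp_all add: mat_def mat2_def matrix_matrix_mult_def sum_2 forall_2 algebra_simps)
  then show ?thesis by blast
qed

definition prop_matrix_at ::
  "(nat \<Rightarrow> real) \<Rightarrow> (nat \<Rightarrow> real) \<Rightarrow> nat \<Rightarrow> real^'n^'n \<Rightarrow> real^('n + 'n)^('n + 'n)" where
  "prop_matrix_at a b m A =
     (let P = prop_poly a b m in
      block_mat (poly_mat (P $ 1 $ 1) A) (poly_mat (P $ 1 $ 2) A)
                (poly_mat (P $ 2 $ 1) A) (poly_mat (P $ 2 $ 2) A))"

definition splitting_approx ::
  "(nat \<Rightarrow> real) \<Rightarrow> (nat \<Rightarrow> real) \<Rightarrow> nat \<Rightarrow> real^'n^'n \<Rightarrow> real \<Rightarrow> nat \<Rightarrow>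
     real^'n \<Rightarrow> real^'n \<Rightarrow> complex^'n" where
  "splitting_approx a b m H \<tau> n q0 p0 =
     (let z = mat_power (prop_matrix_at a b m (\<tau> *\<^sub>R H)) n *v block_vec q0 p0
      in cvec (upper_part z) (lower_part z))"

definition exact_solution :: "real^'n^'n \<Rightarrow> real \<Rightarrow> complex^'n \<Rightarrow> complex^'n" where
  "exact_solution H t u0 = mat_exp (mat (- \<i> * complex_of_real t) ** cmat H) *v u0"

definition stable_matrix :: "real^2^2 \<Rightarrow> bool" where
  "stable_matrix A \<longleftrightarrow> (SUP n\<in>{1..}. ennreal (op_norm (mat_power A n))) < \<infinity>"

definition is_stability_threshold :: "(real \<Rightarrow> real^2^2) \<Rightarrow> real \<Rightarrow> bool" where
  "is_stability_threshold K ystar \<longleftrightarrow>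
     0 \<le> ystar \<and> (\<forall>y\<in>{-ystar<..<ystar}. stable_matrix (K y)) \<and>
     (\<forall>z\<ge>0. (\<forall>y\<in>{-z<..<z}. stable_matrix (K y)) \<longrightarrow> z \<le> ystar)"

definition of_order :: "(real \<Rightarrow> real^2^2) \<Rightarrow> nat \<Rightarrow> bool" where
  "of_order K r \<longleftrightarrow>
     (\<lambda>y. op_norm (K y - mat2 (cos y) (sin y) (- sin y) (cos y))) \<in> O[at 0](\<lambda>y. y ^ (r + 1))"

definition associated_functions ::
  "(real \<Rightarrow> real^2^2) \<Rightarrow> real \<Rightarrow> (real \<Rightarrow> real) \<Rightarrow> (real \<Rightarrow> real) \<Rightarrow> (real \<Rightarrow> real) \<Rightarrow> bool" where
  "associated_functions K ystar \<phi> \<epsilon> \<gamma> \<longleftrightarrow>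
     (\<forall>y\<in>{-ystar<..<ystar}.
        \<phi> (- y) = - \<phi> y \<and> \<epsilon> (- y) = - \<epsilon> y \<and> \<gamma> (- y) = \<gamma> y \<and> \<gamma> y \<noteq> 0 \<and>
        K y = mat2 (cos (\<phi> y) + \<epsilon> y * sin (\<phi> y))              (\<gamma> y * sin (\<phi> y))
                   (- ((1 + (\<epsilon> y)\<^sup>2) / \<gamma> y) * sin (\<phi> y))   (cos (\<phi> y) - \<epsilon> y * sin (\<phi> y)))"


section \<open>Error coefficients\<close>

definition error_matrix :: "(real \<Rightarrow> real) \<Rightarrow> (real \<Rightarrow> real) \<Rightarrow> real \<Rightarrow> real^2^2" where
  "error_matrix \<epsilon> \<gamma> y =
     mat2 (\<epsilon> y) (\<gamma> y - 1) (- ((1 + (\<epsilon> y)\<^sup>2) / \<gamma> y) + 1) (- \<epsilon> y)"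

definition mu :: "(real \<Rightarrow> real) \<Rightarrow> real \<Rightarrow> real \<Rightarrow> ennreal" where
  "mu \<phi> k \<theta> = (SUP y\<in>{0<..\<theta>}. ennreal (\<bar>\<phi> y / y - 1\<bar> * (\<theta> / y) powr k))"

definition nu :: "(real \<Rightarrow> real) \<Rightarrow> (real \<Rightarrow> real) \<Rightarrow> real \<Rightarrow> real \<Rightarrow> ennreal" where
  "nu \<epsilon> \<gamma> k \<theta> = (SUP y\<in>{0<..\<theta>}. ennreal (op_norm (error_matrix \<epsilon> \<gamma> y) * (\<theta> / y) powr k))"

end

theory Submission
  imports Defs
begin

text \<open>
  In an orthonormal eigenbasis of \<open>H\<close> both the method and the exact flow decouple: at an eigenvalue \<open>\<lambda>\<close>
  the method acts by \<open>K(y)^n\<close> with \<open>y = \<tau> \<lambda>\<close>, the exact flow by the rotation by \<open>n y\<close>. Writing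
  \<open>K(y) = cos \<phi> I + sin \<phi> (J + E)\<close>, where \<open>J\<close> generates the rotations and \<open>(J + E)^2 = - I\<close>, one gets
  \<open>K(y)^n = cos (n \<phi>) I + sin (n \<phi>) (J + E)\<close>; its distance from the rotation is at most
  \<open>n \<bar>\<phi> - y\<bar> + \<parallel>E\<parallel>\<close>. Both terms are bounded by the suprema times \<open>(\<bar>y\<bar> / \<theta>)^k = (\<bar>\<lambda>\<bar> / \<rho>)^k\<close>, and Minkowski's
  inequality over the eigenbasis gives the claim.
\<close>

section \<open>Orthonormal eigenbases of symmetric matrices\<close>

text \<open>
  At a maximiser \<open>x\<close> of the Rayleigh quotient with maximum \<open>l\<close>, the form of \<open>l I - f\<close> is positive
  semidefinite on \<open>V\<close> and vanishes at \<open>x\<close>, so \<open>x\<close> lies in its kernel.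
\<close>

lemma rayleigh_eigenvector:
  fixes f :: "'a::euclidean_space \<Rightarrow> 'a"
  assumes f: "linear f" and sym: "\<And>x y. f x \<bullet> y = x \<bullet> f y"
    and V: "subspace V" "V \<noteq> {0}" and inv: "\<And>x. x \<in> V \<Longrightarrow> f x \<in> V"
  obtains x l where "x \<in> V" "norm x = 1" "f x = l *\<^sub>R x"
proof -
  interpret linear f by (fact f)
  let ?S = "sphere 0 1 \<inter> V"
  obtain v where v: "v \<in> V" "v \<noteq> 0"
    using V subspace_0 by blast
  then have "v /\<^sub>R norm v \<in> ?S"
    using V by (simp add: subspace_scale)
  then have ne: "?S \<noteq> {}" by blast
  have "compact ?S"
    using closed_subspace[OF V(1)] by (simp add: compact_Int_closed)
  moreover have "continuous_on ?S (\<lambda>x. x \<bullet> f x)"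
    by (intro continuous_intros linear_continuous_on linear_conv_bounded_linear[THEN iffD1] f)
  ultimately obtain x where x: "x \<in> ?S" and max: "\<And>y. y \<in> ?S \<Longrightarrow> y \<bullet> f y \<le> x \<bullet> f x"
    using continuous_attains_sup[of ?S "\<lambda>x. x \<bullet> f x"] ne by blast
  define l where "l = x \<bullet> f x"
  define w where "w = l *\<^sub>R x - f x"
  have xV: "x \<in> V" and nx: "norm x = 1" "x \<bullet> x = 1" using x by (auto simp: norm_eq_1)
  have wV: "w \<in> V" unfolding w_def using xV inv V(1) by (simp add: subspace_diff subspace_scale)
  have psd: "y \<bullet> f y \<le> l * (y \<bullet> y)" if "y \<in> V" for y
  proof (cases "y = 0")
    case False
    have "y /\<^sub>R norm y \<in> ?S" using that V False by (simp add: subspace_scale)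
    from max[OF this] have "(y \<bullet> f y) / (norm y * norm y) \<le> l"
      by (simp add: l_def scale field_simps)
    then show ?thesis using False
      by (simp add: divide_le_eq dot_square_norm power2_eq_square)
  qed simp
  define c where "c = l * (w \<bullet> w) - w \<bullet> f w"
  have c: "c \<ge> 0" using psd[OF wV] by (simp add: c_def)
  \<comment> \<open>Perturb the maximiser along \<open>w\<close>: since
    \<open>w = l x - f x\<close>, the first-order term of the nonnegative form is
    \<open>2 s (w . w)\<close>, and \<open>c\<close> is the value of the form at
    \<open>w\<close>.\<close>
  have ineq: "2 * s * (w \<bullet> w) + s\<^sup>2 * c \<ge> 0" for s
  proof -
    have "x + s *\<^sub>R w \<in> V" using xV wV V(1) by (simp add: subspace_add subspace_scale)
    from psd[OF this]
    have "0 \<le> l * ((x + s *\<^sub>R w) \<bullet> (x + s *\<^sub>R w)) - (x + s *\<^sub>R w) \<bullet> f (x + s *\<^sub>R w)" by simp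
    also have "\<dots> = 2 * s * ((l *\<^sub>R x - f x) \<bullet> w) + s\<^sup>2 * c"
      using sym[of x w] nx
      by (simp add: add scale inner_simps c_def inner_commute l_def power2_eq_square algebra_simps)
    finally show ?thesis by (simp add: w_def)
  qed
  have "w \<bullet> w = 0"
  proof (rule ccontr)
    define W where "W = w \<bullet> w"
    assume "w \<bullet> w \<noteq> 0"
    then have W: "W > 0" by (simp add: W_def)
    \<comment> \<open>A small negative step lets the linear term beat the quadratic one; the added
      \<open>1\<close> keeps the denominator positive even if \<open>c = 0\<close>.\<close>
    define s where "s = - W / (c + 1)"
    have s: "W = - (s * (c + 1))" "s \<noteq> 0" using W c by (auto simp: s_def)
    have "2 * s * W + s\<^sup>2 * c = - (s\<^sup>2 * (c + 2))"
      by (subst s(1)) (simp add: algebra_simps power2_eq_square)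
    also have "\<dots> < 0" using s(2) c by simp
    finally show False using ineq[of s] by (simp add: W_def)
  qed
  then have "f x = l *\<^sub>R x" by (simp add: w_def)
  with that xV nx show thesis by blast
qed

text \<open>The residual of the expansion is orthogonal to every element of \<open>B\<close>, so it
  lies in the trivial complement.\<close>

lemma orthogonal_complement_trivial_expand:
  fixes B :: "'a::euclidean_space set"
  assumes fin: "finite B"
    and on: "\<And>b c. b \<in> B \<Longrightarrow> c \<in> B \<Longrightarrow> b \<bullet> c = (if b = c then 1 else 0)"
    and triv: "{x. \<forall>b\<in>B. x \<bullet> b = 0} = {0}"
  shows "(\<Sum>b\<in>B. (x \<bullet> b) *\<^sub>R b) = x"
proof -
  have "(x - (\<Sum>b\<in>B. (x \<bullet> b) *\<^sub>R b)) \<bullet> c = 0" if "c \<in> B" for c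
  proof -
    have "(\<Sum>b\<in>B. (x \<bullet> b) * (b \<bullet> c)) = (\<Sum>b\<in>B. if b = c then x \<bullet> b else 0)"
      using on that by (intro sum.cong) auto
    then show ?thesis using fin that by (simp add: inner_diff_left inner_sum_left)
  qed
  then have "x - (\<Sum>b\<in>B. (x \<bullet> b) *\<^sub>R b) \<in> {x. \<forall>b\<in>B. x \<bullet> b = 0}" by simp
  then show ?thesis unfolding triv by simp
qed

text \<open>Eigenvalues are indexed by basis vectors, so sums over \<open>B\<close> respect
  multiplicities. Completeness enters as the expansion formula, the form in which all later
  arguments use it.\<close>

locale eigenbasis =
  fixes H :: "real^'n^'n" and B :: "(real^'n) set" and lam :: "real^'n \<Rightarrow> real"
  assumes finite_B [simp]: "finite B"
    and inner_B: "\<And>b c. b \<in> B \<Longrightarrow> c \<in> B \<Longrightarrow> b \<bullet> c = (if b = c then 1 else 0)"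
    and expand: "\<And>x. (\<Sum>b\<in>B. (x \<bullet> b) *\<^sub>R b) = x"
    and eigen: "\<And>b. b \<in> B \<Longrightarrow> H *v b = lam b *\<^sub>R b"

lemma symmetric_eigenbasis:
  fixes H :: "real^'n^'n"
  assumes "transpose H = H"
  obtains B lam where "eigenbasis H B lam"
proof -
  define orth where "orth = (\<lambda>B. finite B \<and>
    (\<forall>b\<in>B. \<forall>c\<in>B. b \<bullet> c = (if b = c then 1 else 0)) \<and> (\<forall>b\<in>B. \<exists>l. H *v b = l *\<^sub>R b))"
  have card: "card B \<le> DIM(real^'n)" if "orth B" for B
  proof -
    have "pairwise orthogonal B" "0 \<notin> B"
      using that unfolding orth_def pairwise_def orthogonal_def by force+
    then show ?thesis using independent_bound pairwise_orthogonal_independent by blast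
  qed
  \<comment> \<open>A largest orthonormal set of eigenvectors has trivial orthogonal complement.\<close>
  have "orth {}" by (simp add: orth_def)
  then obtain B where B: "orth B" and mx: "\<And>C. orth C \<Longrightarrow> card C \<le> card B"
    using ex_has_greatest_nat[of orth "{}" card "DIM(real^'n) + 1"] card less_Suc_eq_le
    by (metis Suc_eq_plus1)
  have sym: "(H *v x) \<bullet> y = x \<bullet> (H *v y)" for x y
    by (metis assms dot_lmul_matrix vector_transpose_matrix)
  let ?V = "{x. \<forall>b\<in>B. x \<bullet> b = 0}"
  have "?V = {0}"
  proof (rule ccontr)
    assume ne: "?V \<noteq> {0}"
    have sub: "subspace ?V" by (auto simp: subspace_def inner_left_distrib)
    \<comment> \<open>Symmetry moves \<open>H\<close> onto the eigenvector \<open>b\<close>, so the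
      complement is invariant and itself contains a unit eigenvector, which would enlarge
      \<open>B\<close>.\<close>
    have inv: "H *v x \<in> ?V" if "x \<in> ?V" for x
    proof -
      have "(H *v x) \<bullet> b = 0" if "b \<in> B" for b
      proof -
        obtain l where "H *v b = l *\<^sub>R b" using B \<open>b \<in> B\<close> unfolding orth_def by blast
        then show ?thesis using \<open>x \<in> ?V\<close> that by (simp add: sym)
      qed
      then show ?thesis by simp
    qed
    obtain x l where x: "x \<in> ?V" "norm x = 1" "H *v x = l *\<^sub>R x"
      by (rule rayleigh_eigenvector[OF matrix_vector_mul_linear sym sub ne inv])
    have xB: "x \<notin> B" using x by (auto simp: norm_eq_1)
    have "orth (insert x B)"
      using B x by (auto simp: orth_def norm_eq_1 inner_commute)
    from mx[OF this] show False using xB B by (simp add: orth_def)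
  qed
  then have "eigenbasis H B (\<lambda>b. SOME l. H *v b = l *\<^sub>R b)"
    using B orthogonal_complement_trivial_expand[of B]
    by unfold_locales (auto simp: orth_def intro: someI_ex)
  then show thesis by (rule that)
qed

section \<open>Functional calculus in an eigenbasis\<close>

lemma mat_power_mult_vec_Suc: "mat_power A (Suc j) *v x = A *v (mat_power A j *v x)"
  by (simp add: matrix_vector_mul_assoc)

lemma mult_vec_scaleR: "A *v (c *\<^sub>R u) = c *\<^sub>R (A *v u)" for A :: "complex^'n^'m"
  by (simp add: vec_eq_iff matrix_vector_mult_def scaleR_sum_right)

lemma scaleC_scaleR: "z *s (c *\<^sub>R u) = c *\<^sub>R (z *s u)" for u :: "complex^'n"
  by (simp add: vec_eq_iff)

lemma sum_scaleR_mult_vec: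
  fixes M :: "'i \<Rightarrow> real^'n^'m"
  shows "(\<Sum>i\<in>I. c i *\<^sub>R M i) *v x = (\<Sum>i\<in>I. c i *\<^sub>R (M i *v x))"
  by (induction I rule: infinite_finite_induct)
    (simp_all add: matrix_vector_mult_add_rdistrib scaleR_matrix_vector_assoc)

context eigenbasis
begin

definition ccomb :: "(real^'n \<Rightarrow> complex) \<Rightarrow> complex^'n" where
  "ccomb h = (\<chi> i. \<Sum>b\<in>B. h b * complex_of_real (b $ i))"

text \<open>The spectral calculus: \<open>g\<close> weights the orthogonal projections onto the
  lines spanned by the basis vectors.\<close>

definition fmat :: "(real^'n \<Rightarrow> complex) \<Rightarrow> complex^'n^'n" where
  "fmat g = (\<chi> i j. \<Sum>b\<in>B. g b * complex_of_real (b $ i * b $ j))"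

definition comb :: "(real^'n \<Rightarrow> real) \<Rightarrow> real^'n" where
  "comb f = (\<Sum>b\<in>B. f b *\<^sub>R b)"

lemma comb_inner_self: "comb f \<bullet> comb f = (\<Sum>b\<in>B. (f b)\<^sup>2)"
proof -
  have "comb f \<bullet> comb f = (\<Sum>b\<in>B. \<Sum>c\<in>B. f b * (f c * (c \<bullet> b)))"
    unfolding comb_def inner_sum_left inner_sum_right inner_scaleR_left inner_scaleR_right
      sum_distrib_left by (rule refl)
  also have "\<dots> = (\<Sum>b\<in>B. \<Sum>c\<in>B. if c = b then f b * f b else 0)"
    by (intro sum.cong) (auto simp: inner_B)
  finally show ?thesis by (simp add: power2_eq_square)
qed

lemma cvec_comb: "cvec (comb f) (comb g) = ccomb (\<lambda>b. Complex (f b) (g b))"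
proof -
  have "Complex ((\<Sum>b\<in>B. f b *\<^sub>R b) $ i) ((\<Sum>b\<in>B. g b *\<^sub>R b) $ i)
    = (\<Sum>b\<in>B. Complex (f b) (g b) * complex_of_real (b $ i))" for i
    by (simp add: complex_eq_iff)
  then show ?thesis by (simp add: vec_eq_iff cvec_def comb_def ccomb_def)
qed

lemma ccomb_eq_cvec: "ccomb h = cvec (comb (\<lambda>b. Re (h b))) (comb (\<lambda>b. Im (h b)))"
  by (simp add: cvec_comb)

lemma norm_cvec: "(norm (cvec q p))\<^sup>2 = q \<bullet> q + p \<bullet> p"
  by (simp add: cvec_def norm_vec_def L2_set_def sum_nonneg cmod_power2 inner_vec_def sum.distrib)
    (simp add: power2_eq_square)

text \<open>Parseval's identity, applied to real and imaginary parts separately since the basis is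
  real.\<close>

lemma norm_ccomb: "norm (ccomb h) = L2_set (\<lambda>b. cmod (h b)) B"
proof -
  have "(norm (ccomb h))\<^sup>2 = (\<Sum>b\<in>B. (cmod (h b))\<^sup>2)"
    by (simp add: ccomb_eq_cvec norm_cvec comb_inner_self cmod_power2 sum.distrib)
  then show ?thesis by (simp add: L2_set_def real_sqrt_unique)
qed

lemma ccomb_diff: "ccomb f - ccomb g = ccomb (\<lambda>b. f b - g b)"
  by (simp add: ccomb_def vec_eq_iff sum_subtractf algebra_simps)

lemma ccomb_scaleC: "z *s ccomb h = ccomb (\<lambda>b. z * h b)"
  by (simp add: ccomb_def vec_eq_iff sum_distrib_left mult.assoc)

lemma ccomb_eq_0_iff: "ccomb h = 0 \<longleftrightarrow> (\<forall>b\<in>B. h b = 0)"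
  unfolding norm_eq_zero[of "ccomb h", symmetric] norm_ccomb by (simp add: L2_set_eq_0_iff)

lemma ccomb_eq_iff: "ccomb f = ccomb g \<longleftrightarrow> (\<forall>b\<in>B. f b = g b)"
  using ccomb_eq_0_iff[of "\<lambda>b. f b - g b"] by (simp flip: ccomb_diff)

lemma comb_expand: "comb (\<lambda>b. x \<bullet> b) = x"
  by (simp add: comb_def expand)

lemma cvec_expand: "cvec q p = ccomb (\<lambda>b. Complex (q \<bullet> b) (p \<bullet> b))"
  using cvec_comb[of "\<lambda>b. q \<bullet> b" "\<lambda>b. p \<bullet> b"] by (simp add: comb_expand)

lemma ccomb_exists: obtains h where "u = ccomb h"
proof -
  have "u = cvec (\<chi> i. Re (u $ i)) (\<chi> i. Im (u $ i))"
    by (simp add: cvec_def vec_eq_iff)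
  then show thesis using that cvec_expand by metis
qed

lemma mult_comb: "H *v comb f = comb (\<lambda>b. lam b * f b)"
proof -
  have "H *v comb f = (\<Sum>b\<in>B. f b *\<^sub>R (H *v b))"
    by (simp add: comb_def linear_sum[OF matrix_vector_mul_linear] matrix_vector_mult_scaleR)
  also have "\<dots> = comb (\<lambda>b. lam b * f b)"
    unfolding comb_def by (intro sum.cong) (simp_all add: eigen mult.commute)
  finally show ?thesis .
qed

lemma mat_power_comb: "mat_power H j *v comb f = comb (\<lambda>b. lam b ^ j * f b)"
  by (induction j) (simp_all add: mat_power_mult_vec_Suc mult_comb mult.assoc del: mat_power.simps(2))

lemma poly_mat_comb: "poly_mat p H *v comb f = comb (\<lambda>b. poly p (lam b) * f b)"
proof -
  have "poly_mat p H *v comb f = (\<Sum>j\<le>degree p. coeff p j *\<^sub>R comb (\<lambda>b. lam b ^ j * f b))"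
    unfolding poly_mat_def by (simp add: sum_scaleR_mult_vec mat_power_comb)
  also have "\<dots> = (\<Sum>b\<in>B. \<Sum>j\<le>degree p. (coeff p j * (lam b ^ j * f b)) *\<^sub>R b)"
    unfolding comb_def scaleR_sum_right scaleR_scaleR by (rule sum.swap)
  also have "\<dots> = comb (\<lambda>b. poly p (lam b) * f b)"
    by (simp add: comb_def poly_altdef sum_distrib_right scaleR_sum_left mult.assoc)
  finally show ?thesis .
qed

section \<open>Powers and exponentials of the complexified matrix\<close>

lemma cmat_ccomb: "cmat H *v ccomb h = ccomb (\<lambda>b. complex_of_real (lam b) * h b)"
proof -
  have "cmat H *v cvec q p = cvec (H *v q) (H *v p)" for q p
    by (simp add: vec_eq_iff cmat_def matrix_vector_mult_def cvec_def complex_eq_iff)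
  then show ?thesis
    by (simp add: ccomb_eq_cvec mult_comb)
qed

lemma fmat_ccomb: "fmat g *v ccomb h = ccomb (\<lambda>b. g b * h b)"
proof -
  have "(fmat g *v ccomb h) $ i = ccomb (\<lambda>b. g b * h b) $ i" for i
  proof -
    have "(fmat g *v ccomb h) $ i =
        (\<Sum>j\<in>UNIV. \<Sum>b\<in>B. \<Sum>c\<in>B. g b * h c * (b $ i) * complex_of_real (b $ j * c $ j))"
      unfolding fmat_def ccomb_def matrix_vector_mult_def by (simp add: sum_product) (simp add: mult_ac)
    also have "\<dots> = (\<Sum>b\<in>B. \<Sum>c\<in>B. \<Sum>j\<in>UNIV. g b * h c * (b $ i) * complex_of_real (b $ j * c $ j))"
      by (subst sum.swap, intro sum.cong refl, rule sum.swap)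
    also have "\<dots> = (\<Sum>b\<in>B. \<Sum>c\<in>B. g b * h c * (b $ i) * complex_of_real (b \<bullet> c))"
      by (simp add: inner_vec_def sum_distrib_left)
    also have "\<dots> = (\<Sum>b\<in>B. \<Sum>c\<in>B. if c = b then g b * h b * (b $ i) else 0)"
      by (intro sum.cong) (auto simp: inner_B)
    finally show ?thesis by (simp add: ccomb_def)
  qed
  then show ?thesis by (simp add: vec_eq_iff)
qed

lemma matrix_eqI_ccomb: "(\<And>h. A *v ccomb h = A' *v ccomb h) \<Longrightarrow> A = A'"
  by (metis ccomb_exists matrix_eq)

text \<open>The factor \<open>z\<close> serves two purposes: a general \<open>z\<close> for the
  terms of the exponential series, and \<open>z = 1\<close> for the powers of \<open>H\<close> in
  the graph norms.\<close>

lemma mat_power_scaled_cmat: "mat_power (mat z ** cmat H) j = fmat (\<lambda>b. (z * complex_of_real (lam b)) ^ j)"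
proof (induction j)
  case 0
  show ?case by (rule matrix_eqI_ccomb) (simp add: fmat_ccomb)
next
  case (Suc j)
  have "mat z *v u = z *s u" for u :: "complex^'n"
    by (simp add: vec_eq_iff mat_def matrix_vector_mult_def if_distrib[of "\<lambda>x. x * _"] cong: if_cong)
  then show ?case
    by (intro matrix_eqI_ccomb)
      (simp add: Suc fmat_ccomb cmat_ccomb ccomb_scaleC mult.assoc flip: matrix_vector_mul_assoc)
qed

text \<open>Each matrix entry of the series is a finite combination of scalar exponential series, so
  convergence is checked entrywise.\<close>

lemma mat_exp_ccomb:
  "mat_exp (mat z ** cmat H) *v ccomb h = ccomb (\<lambda>b. exp (z * complex_of_real (lam b)) * h b)"
proof -
  let ?w = "\<lambda>b. z * complex_of_real (lam b)"
  have "(\<lambda>j. \<Sum>b\<in>B. ((1 / fact j) *\<^sub>R ?w b ^ j) * complex_of_real (b $ i * b $ k)) sums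
      (\<Sum>b\<in>B. exp (?w b) * complex_of_real (b $ i * b $ k))" for i k
  proof (rule sums_sum, rule sums_mult2)
    show "(\<lambda>j. (1 / fact j) *\<^sub>R ?w b ^ j) sums exp (?w b)" for b
      using exp_converges[of "?w b"] by (simp add: divide_inverse)
  qed
  moreover have "((1 / fact j) *\<^sub>R fmat (\<lambda>b. ?w b ^ j)) $ i $ k
      = (\<Sum>b\<in>B. ((1 / fact j) *\<^sub>R ?w b ^ j) * complex_of_real (b $ i * b $ k))" for i j k
    by (simp add: fmat_def scaleR_sum_right)
  ultimately have "(\<lambda>j. (1 / fact j) *\<^sub>R fmat (\<lambda>b. ?w b ^ j)) sums fmat (\<lambda>b. exp (?w b))"
    unfolding sums_def
    by (intro vec_tendstoI) (simp add: fmat_def)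
  then have "mat_exp (mat z ** cmat H) = fmat (\<lambda>b. exp (?w b))"
    unfolding mat_exp_def mat_power_scaled_cmat by (rule sums_unique[symmetric])
  then show ?thesis by (simp add: fmat_ccomb)
qed

section \<open>Eigenspaces, fractional powers and graph norms in coordinates\<close>

lemma mem_eigenspace_iff: "ccomb h \<in> eigenspace (cmat H) z \<longleftrightarrow>
    (\<forall>b\<in>B. complex_of_real (lam b) = z \<or> h b = 0)"
  by (auto simp: eigenspace_def cmat_ccomb ccomb_scaleC ccomb_eq_iff)

lemma eigenvalues_eq: "eigenvalues (cmat H) = (\<lambda>b. complex_of_real (lam b)) ` B"
proof (intro equalityI subsetI)
  fix z assume "z \<in> eigenvalues (cmat H)"
  then obtain v where v: "v \<noteq> 0" "v \<in> eigenspace (cmat H) z"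
    by (auto simp: eigenvalues_def eigenspace_def)
  obtain h where h: "v = ccomb h" by (rule ccomb_exists)
  show "z \<in> (\<lambda>b. complex_of_real (lam b)) ` B"
    using v unfolding h mem_eigenspace_iff ccomb_eq_0_iff by auto
next
  fix z assume "z \<in> (\<lambda>b. complex_of_real (lam b)) ` B"
  then obtain c where c: "c \<in> B" "z = complex_of_real (lam c)" by blast
  let ?v = "ccomb (\<lambda>b. if b = c then 1 else 0)"
  have "?v \<in> eigenspace (cmat H) z" "?v \<noteq> 0"
    using c by (auto simp: mem_eigenspace_iff ccomb_eq_0_iff)
  then show "z \<in> eigenvalues (cmat H)"
    by (auto simp: eigenvalues_def eigenspace_def)
qed

text \<open>Distances are \<open>L2_set\<close> norms of coordinates, so the projection is optimal coordinate by coordinate.\<close>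

lemma closest_point_eigenspace: "closest_point (eigenspace (cmat H) z) (ccomb h) =
    ccomb (\<lambda>b. if complex_of_real (lam b) = z then h b else 0)" (is "_ = ?p")
proof (rule closest_point_unique[symmetric])
  let ?S = "eigenspace (cmat H) z"
  have S: "subspace ?S"
    by (auto simp: subspace_def eigenspace_def matrix_vector_right_distrib vector_add_ldistrib
        mult_vec_scaleR scaleC_scaleR)
  show "convex ?S" "closed ?S"
    using S by (auto intro: subspace_imp_convex closed_subspace)
  show "?p \<in> ?S" by (simp add: mem_eigenspace_iff)
  show "\<forall>v\<in>?S. dist (ccomb h) ?p \<le> dist (ccomb h) v"
  proof
    fix v assume v: "v \<in> ?S"
    obtain g where g: "v = ccomb g" by (rule ccomb_exists)
    show "dist (ccomb h) ?p \<le> dist (ccomb h) v"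
      using v unfolding g mem_eigenspace_iff dist_norm ccomb_diff norm_ccomb
      by (intro L2_set_mono) auto
  qed
qed

text \<open>Each \<open>b\<close> lies in exactly one eigenspace, so after exchanging the sums only
  \<open>z = lam b\<close> survives, even when basis vectors share an eigenvalue.\<close>

lemma abs_powr_apply_ccomb:
  "abs_powr_apply H s (ccomb h) = ccomb (\<lambda>b. complex_of_real (\<bar>lam b\<bar> powr s) * h b)"
proof -
  let ?L = "(\<lambda>b. complex_of_real (lam b)) ` B"
  have "(\<Sum>z\<in>?L. cmod z powr s *\<^sub>R ccomb (\<lambda>b. if complex_of_real (lam b) = z then h b else 0)) $ i
      = ccomb (\<lambda>b. complex_of_real (\<bar>lam b\<bar> powr s) * h b) $ i" for i
  proof -
    have "(\<Sum>z\<in>?L. cmod z powr s *\<^sub>R ccomb (\<lambda>b. if complex_of_real (lam b) = z then h b else 0)) $ i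
        = (\<Sum>b\<in>B. \<Sum>z\<in>?L. if complex_of_real (lam b) = z
            then complex_of_real (\<bar>lam b\<bar> powr s) * h b * complex_of_real (b $ i) else 0)"
      by (subst sum.swap, simp add: ccomb_def scaleR_sum_right, intro sum.cong refl)
        (auto simp: scaleR_conv_of_real)
    then show ?thesis by (simp add: ccomb_def)
  qed
  then show ?thesis
    unfolding abs_powr_apply_def eigenvalues_eq closest_point_eigenspace by (simp add: vec_eq_iff)
qed

text \<open>Unifies the integer and fractional cases of the graph norm. The case
  \<open>s = 0\<close> is separate because \<open>0 powr 0 = 0\<close>, whereas
  \<open>H^0 = I\<close> also on the kernel.\<close>

lemma norm_H_ccomb:
  assumes "s \<ge> 0"
  shows "norm_H H s (ccomb h) =
    L2_set (\<lambda>b. (if s = 0 then 1 else \<bar>lam b\<bar> powr s) * cmod (h b)) B"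
proof (cases "s \<in> \<nat>")
  case True
  then obtain j where j: "s = real j" by (auto simp: Nats_def)
  have "mat_power (cmat H) j *v ccomb h = ccomb (\<lambda>b. complex_of_real (lam b) ^ j * h b)"
    using mat_power_scaled_cmat[of 1 j] by (simp add: fmat_ccomb)
  moreover have "\<bar>lam b\<bar> ^ j = (if s = 0 then 1 else \<bar>lam b\<bar> powr s)" for b
    by (cases "j = 0") (simp_all add: j powr_realpow')
  ultimately show ?thesis
    using True by (simp add: norm_H_def j norm_ccomb norm_mult norm_power)
next
  case False
  then have "s \<noteq> 0" by auto
  with False show ?thesis
    by (auto simp: norm_H_def abs_powr_apply_ccomb norm_ccomb norm_mult)
qed

end

section \<open>The method and the exact flow in an eigenbasis\<close>

lemma eigenbasis_scaleR:
  assumes "eigenbasis H B lam"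
  shows "eigenbasis (c *\<^sub>R H) B (\<lambda>b. c * lam b)"
proof -
  interpret eigenbasis H B lam by fact
  show ?thesis
    by unfold_locales (auto simp: inner_B expand eigen simp flip: scaleR_matrix_vector_assoc)
qed

lemma block_mat_mult_block_vec:
  fixes A :: "'a::semiring_1^'n^'n"
  shows "block_mat A B C D *v block_vec q p = block_vec (A *v q + B *v p) (C *v q + D *v p)"
proof -
  have "(\<Sum>j\<in>UNIV. f j) = (\<Sum>j\<in>UNIV. f (Inl j)) + (\<Sum>j\<in>UNIV. f (Inr j))" for f :: "'n + 'n \<Rightarrow> 'a"
    using sum.Plus[of UNIV UNIV f] by simp
  then show ?thesis
    by (simp add: vec_eq_iff block_mat_def block_vec_def matrix_vector_mult_def split: sum.split)
qed

lemma mult_vec_2: "(K *v w) $ i = K $ i $ 1 * w $ 1 + K $ i $ 2 * w $ 2" for w :: "'a::semiring_1^2"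
  by (simp add: matrix_vector_mult_def sum_2)

context eigenbasis
begin

lemma comb_add: "comb f + comb g = comb (\<lambda>b. f b + g b)"
  by (simp add: comb_def sum.distrib scaleR_left_distrib)

lemma prop_matrix_at_comb:
  "prop_matrix_at a b m H *v block_vec (comb f) (comb g) =
    block_vec (comb (\<lambda>c. (prop_matrix a b m (lam c) *v vector [f c, g c]) $ 1))
              (comb (\<lambda>c. (prop_matrix a b m (lam c) *v vector [f c, g c]) $ 2))"
  by (simp add: prop_matrix_at_def Let_def block_mat_mult_block_vec poly_mat_comb poly_prop_poly
      comb_add mult_vec_2)

text \<open>The block matrix preserves the plane of position and momentum along each eigenvector and
  acts there as the 2x2 propagation matrix, so its powers decouple as well.\<close>

lemma mat_power_prop_matrix_at_comb:
  "mat_power (prop_matrix_at a b m H) n *v block_vec (comb f) (comb g) =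
    block_vec (comb (\<lambda>c. (mat_power (prop_matrix a b m (lam c)) n *v vector [f c, g c]) $ 1))
              (comb (\<lambda>c. (mat_power (prop_matrix a b m (lam c)) n *v vector [f c, g c]) $ 2))"
proof (induction n)
  case (Suc n)
  have "vector [w $ 1, w $ 2] = w" for w :: "real^2"
    by (simp add: vec_eq_iff forall_2)
  then show ?case
    unfolding mat_power_mult_vec_Suc Suc prop_matrix_at_comb by simp
qed simp

lemma splitting_approx_eq:
  "splitting_approx a b m H \<tau> n q p =
    ccomb (\<lambda>c. let w = mat_power (prop_matrix a b m (\<tau> * lam c)) n *v vector [q \<bullet> c, p \<bullet> c]
               in Complex (w $ 1) (w $ 2))"
proof -
  \<comment> \<open>The method is evaluated at \<open>\<tau> H\<close>, which has the same
    eigenbasis with scaled eigenvalues.\<close>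
  interpret scaled: eigenbasis "\<tau> *\<^sub>R H" B "\<lambda>b. \<tau> * lam b"
    using eigenbasis_scaleR eigenbasis_axioms .
  note power = scaled.mat_power_prop_matrix_at_comb[of _ _ _ _ "\<lambda>b. q \<bullet> b" "\<lambda>b. p \<bullet> b",
      unfolded comb_expand]
  have "upper_part (block_vec x y) = x" "lower_part (block_vec x y) = y" for x y :: "real^'n"
    by (simp_all add: vec_eq_iff upper_part_def lower_part_def block_vec_def)
  then show ?thesis
    by (simp add: splitting_approx_def power Let_def cvec_comb)
qed

lemma exact_solution_eq:
  "exact_solution H t (cvec q p) = ccomb (\<lambda>b. cis (- t * lam b) * Complex (q \<bullet> b) (p \<bullet> b))"
  by (simp add: exact_solution_def cvec_expand mat_exp_ccomb cis_conv_exp mult_ac)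

lemma spectral_radius_eq: "spectral_radius H = Max ((\<lambda>b. \<bar>lam b\<bar>) ` B)"
  by (simp add: spectral_radius_def eigenvalues_eq image_image)

lemma abs_lam_le_spectral_radius: "b \<in> B \<Longrightarrow> \<bar>lam b\<bar> \<le> spectral_radius H"
  by (simp add: spectral_radius_eq)

lemma spectral_radius_pos:
  assumes "H \<noteq> 0"
  shows "spectral_radius H > 0"
proof -
  have "\<exists>b\<in>B. lam b \<noteq> 0"
  proof (rule ccontr)
    assume "\<not> (\<exists>b\<in>B. lam b \<noteq> 0)"
    then have "comb (\<lambda>b. lam b * (x \<bullet> b)) = 0" for x
      by (simp add: comb_def)
    then have "H *v x = 0 *v x" for x
      by (simp flip: mult_comb add: comb_expand)
    then have "H = 0" using matrix_eq by blast
    with assms show False by blast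
  qed
  then show ?thesis using abs_lam_le_spectral_radius by fastforce
qed

end

section \<open>The one-frequency estimate\<close>

lemma mat2_nth [simp]:
  "mat2 p q r s $ 1 $ 1 = p" "mat2 p q r s $ 1 $ 2 = q"
  "mat2 p q r s $ 2 $ 1 = r" "mat2 p q r s $ 2 $ 2 = s"
  by (simp_all add: mat2_def)

lemma mat2_eq_iff: "A = A' \<longleftrightarrow>
    A $ 1 $ 1 = A' $ 1 $ 1 \<and> A $ 1 $ 2 = A' $ 1 $ 2 \<and> A $ 2 $ 1 = A' $ 2 $ 1 \<and> A $ 2 $ 2 = A' $ 2 $ 2"
  for A A' :: "'a^2^2"
  by (simp add: vec_eq_iff forall_2)

text \<open>This is \<open>cos x I + sin x N\<close> with \<open>N\<close> of trace 0 and
  determinant 1 (for \<open>g\<close> nonzero), hence \<open>N^2 = - I\<close> by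
  Cayley-Hamilton.\<close>

definition elliptic :: "real \<Rightarrow> real \<Rightarrow> real \<Rightarrow> real^2^2" where
  "elliptic x e g = mat2 (cos x + e * sin x) (g * sin x)
                         (- ((1 + e\<^sup>2) / g) * sin x) (cos x - e * sin x)"

text \<open>For fixed \<open>e\<close> and \<open>g\<close> these matrices form a one-parameter
  group by the addition formulas, so powers only multiply the angle.\<close>

lemma elliptic_mult:
  assumes "g \<noteq> 0"
  shows "elliptic x e g ** elliptic y e g = elliptic (x + y) e g"
proof -
  define d where "d = (1 + e\<^sup>2) / g"
  have d: "g * d = 1 + e * e" using assms by (simp add: d_def power2_eq_square)
  \<comment> \<open>The relation \<open>g d = 1 + e^2\<close> multiplied by an arbitrary
    \<open>z\<close>, so that it also rewrites inside right-nested products.\<close>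
  have g: "d * (g * z) = z + e * (e * z)" for z
    using d by (metis distrib_right mult.assoc mult.commute mult_1)
  show ?thesis
    unfolding elliptic_def d_def[symmetric]
    by (simp add: mat2_eq_iff matrix_matrix_mult_def sum_2 cos_add sin_add algebra_simps g)
qed

lemma mat_power_elliptic:
  assumes "g \<noteq> 0"
  shows "mat_power (elliptic x e g) n = elliptic (real n * x) e g"
proof (induction n)
  case 0
  show ?case by (simp add: elliptic_def mat2_eq_iff mat_def)
next
  case (Suc n)
  then show ?case by (simp add: elliptic_mult[OF assms] algebra_simps)
qed

lemma norm_real2: "norm w = cmod (Complex (w $ 1) (w $ 2))" for w :: "real^2"
  by (simp add: norm_vec_def L2_set_def sum_2 cmod_def)

text \<open>A chord is no longer than its arc: its length is
  \<open>2 |sin ((x - y) / 2)|\<close>.\<close>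

lemma norm_cis_diff_le: "cmod (cis x - cis y) \<le> \<bar>x - y\<bar>"
proof -
  have "cis x - cis y = cis y * (cis (x - y) - 1)"
    by (simp add: cis_mult right_diff_distrib)
  then have "cmod (cis x - cis y) = cmod (cis (x - y) - 1)"
    by (simp add: norm_mult)
  also have "\<dots> \<le> \<bar>x - y\<bar>"
    using dist_exp_i_1[of "x - y"] abs_sin_x_le_abs_x[of "(x - y) / 2"]
    by (simp add: cis_conv_exp)
  finally show ?thesis .
qed

text \<open>Splits \<open>N = J + E\<close>: the part \<open>cos x I + sin x J\<close> is a
  rotation, that is multiplication by \<open>cis (- x)\<close> under the identification of the plane
  with the complex numbers.\<close>

lemma elliptic_mult_vec_eq:
  fixes w :: "real^2" and e g :: "real \<Rightarrow> real" and x y :: real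
  defines "v \<equiv> elliptic x (e y) (g y) *v w" and "u \<equiv> error_matrix e g y *v w"
  shows "Complex (v $ 1) (v $ 2) =
    cis (- x) * Complex (w $ 1) (w $ 2) + of_real (sin x) * Complex (u $ 1) (u $ 2)"
  unfolding v_def u_def mult_vec_2 elliptic_def error_matrix_def
  by (simp add: complex_eq_iff algebra_simps)

text \<open>The rotations differ by at most their angle difference, and \<open>E\<close> carries the
  factor \<open>sin x\<close>, bounded by 1 however large the angle is.\<close>

lemma elliptic_error_le:
  fixes w :: "real^2" and e g :: "real \<Rightarrow> real" and x y z :: real
  defines "v \<equiv> elliptic x (e y) (g y) *v w"
  shows "cmod (Complex (v $ 1) (v $ 2) - cis (- z) * Complex (w $ 1) (w $ 2)) \<le>
    (\<bar>x - z\<bar> + op_norm (error_matrix e g y)) * norm w"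
proof -
  let ?w = "Complex (w $ 1) (w $ 2)"
  let ?u = "error_matrix e g y *v w"
  have "Complex (v $ 1) (v $ 2) - cis (- z) * ?w =
      (cis (- x) - cis (- z)) * ?w + of_real (sin x) * Complex (?u $ 1) (?u $ 2)"
    unfolding v_def elliptic_mult_vec_eq by (simp add: algebra_simps)
  also have "cmod \<dots> \<le> cmod (cis (- x) - cis (- z)) * norm w + \<bar>sin x\<bar> * norm ?u"
    by (rule order_trans[OF norm_triangle_ineq]) (simp add: norm_mult norm_real2)
  also have "\<dots> \<le> \<bar>x - z\<bar> * norm w + 1 * (op_norm (error_matrix e g y) * norm w)"
    using norm_cis_diff_le[of "- x" "- z"] onorm[OF matrix_vector_mul_bounded_linear, of "error_matrix e g y" w]
    by (intro add_mono mult_mono) auto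
  finally show ?thesis by (simp add: algebra_simps)
qed

text \<open>\<open>E(-y)\<close> is \<open>- D E(y) D\<close> for the reflection \<open>D = diag(1, -1)\<close>.\<close>

lemma op_norm_error_matrix_le:
  assumes "e (- y) = - e y" "g (- y) = g y"
  shows "op_norm (error_matrix e g (- y)) \<le> op_norm (error_matrix e g y)"
proof (rule onorm_le)
  fix w :: "real^2"
  define w' :: "real^2" where "w' = vector [w $ 1, - w $ 2]"
  have "norm (error_matrix e g (- y) *v w) = norm (error_matrix e g y *v w')"
    unfolding norm_real2 mult_vec_2
    by (simp add: error_matrix_def assms w'_def cmod_def)
      (simp add: power2_eq_square algebra_simps)
  also have "\<dots> \<le> op_norm (error_matrix e g y) * norm w'"
    by (rule onorm) simp
  also have "norm w' = norm w" by (simp add: norm_real2 w'_def cmod_def)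
  finally show "norm (error_matrix e g (- y) *v w) \<le> op_norm (error_matrix e g y) * norm w" .
qed

text \<open>The phase error grows linearly in \<open>n\<close>, while \<open>E\<close> counts only
  once since powers keep \<open>\<epsilon>\<close> and \<open>\<gamma>\<close>. Parity reduces to
  \<open>|y|\<close>, because the suprema run over positive arguments. They omit
  \<open>y = 0\<close>, where oddness gives \<open>\<phi> 0 = 0\<close> and hence no error.\<close>

lemma one_frequency_error:
  fixes K :: "real \<Rightarrow> real^2^2" and w :: "real^2" and y :: real and n :: nat
  assumes K: "associated_functions K ystar \<phi> \<epsilon> \<gamma>" and y: "\<bar>y\<bar> < ystar"
  defines "v \<equiv> mat_power (K y) n *v w"
  defines "d \<equiv> cmod (Complex (v $ 1) (v $ 2) - cis (- (real n * y)) * Complex (w $ 1) (w $ 2))"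
  shows "d \<le> (real n * \<bar>\<phi> \<bar>y\<bar> - \<bar>y\<bar>\<bar> + op_norm (error_matrix \<epsilon> \<gamma> \<bar>y\<bar>)) * norm w"
    and "y = 0 \<Longrightarrow> d = 0"
proof -
  have at_y: "\<phi> (- y) = - \<phi> y" "\<epsilon> (- y) = - \<epsilon> y" "\<gamma> (- y) = \<gamma> y" "\<gamma> y \<noteq> 0"
    and Ky: "K y = elliptic (\<phi> y) (\<epsilon> y) (\<gamma> y)"
    using K y by (auto simp: associated_functions_def elliptic_def abs_less_iff)
  have v: "v = elliptic (real n * \<phi> y) (\<epsilon> y) (\<gamma> y) *v w"
    unfolding v_def Ky mat_power_elliptic[OF at_y(4)] ..
  have phase: "\<bar>real n * \<phi> y - real n * y\<bar> = real n * \<bar>\<phi> \<bar>y\<bar> - \<bar>y\<bar>\<bar>"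
    using at_y(1) by (cases "y \<ge> 0") (simp_all add: abs_mult abs_minus_commute flip: right_diff_distrib)
  have "op_norm (error_matrix \<epsilon> \<gamma> y) \<le> op_norm (error_matrix \<epsilon> \<gamma> \<bar>y\<bar>)"
    using op_norm_error_matrix_le[of \<epsilon> "- y" \<gamma>] at_y by (cases "y \<ge> 0") auto
  then have "(real n * \<bar>\<phi> \<bar>y\<bar> - \<bar>y\<bar>\<bar> + op_norm (error_matrix \<epsilon> \<gamma> y)) * norm w
      \<le> (real n * \<bar>\<phi> \<bar>y\<bar> - \<bar>y\<bar>\<bar> + op_norm (error_matrix \<epsilon> \<gamma> \<bar>y\<bar>)) * norm w"
    by (intro mult_right_mono) auto
  with elliptic_error_le[of "real n * \<phi> y" \<epsilon> y \<gamma> w "real n * y", unfolded phase]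
  show "d \<le> (real n * \<bar>\<phi> \<bar>y\<bar> - \<bar>y\<bar>\<bar> + op_norm (error_matrix \<epsilon> \<gamma> \<bar>y\<bar>)) * norm w"
    unfolding d_def v by (rule order_trans)
  show "d = 0" if "y = 0"
  proof -
    have "\<phi> y = 0" using at_y(1) that by simp
    then have "v = w"
      unfolding v by (simp add: vec_eq_iff forall_2 mult_vec_2 elliptic_def)
    then show ?thesis using that by (simp add: d_def)
  qed
qed

lemma powr_rescale: "0 < x \<Longrightarrow> 0 < \<theta> \<Longrightarrow> c * (\<theta> / x) powr k \<le> M \<Longrightarrow> c \<le> M * (x / \<theta>) powr k"
  for x \<theta> c k M :: real
proof -
  assume x: "0 < x" "0 < \<theta>" and c: "c * (\<theta> / x) powr k \<le> M"
  have "(\<theta> / x) powr k * (x / \<theta>) powr k = 1"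
    using x by (simp flip: powr_mult)
  then have "c = c * (\<theta> / x) powr k * (x / \<theta>) powr k" by (simp add: mult.assoc)
  also have "\<dots> \<le> M * (x / \<theta>) powr k" using c by (intro mult_right_mono) auto
  finally show ?thesis .
qed

text \<open>Bounds on the weighted quantities turn into the factor
  \<open>(|y| / \<theta>) powr k\<close>; the phase error is \<open>|y|\<close> times the relative
  one, which produces \<open>n |y|\<close>.\<close>

lemma one_frequency_error_powr:
  fixes K :: "real \<Rightarrow> real^2^2" and w :: "real^2" and y :: real and n :: nat
  assumes K: "associated_functions K ystar \<phi> \<epsilon> \<gamma>"
    and \<theta>: "0 < \<theta>" "\<theta> < ystar" and y: "y \<noteq> 0" "\<bar>y\<bar> \<le> \<theta>"
    and M: "\<bar>\<phi> \<bar>y\<bar> / \<bar>y\<bar> - 1\<bar> * (\<theta> / \<bar>y\<bar>) powr k \<le> M"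
    and V: "op_norm (error_matrix \<epsilon> \<gamma> \<bar>y\<bar>) * (\<theta> / \<bar>y\<bar>) powr k \<le> V"
  defines "v \<equiv> mat_power (K y) n *v w"
  shows "cmod (Complex (v $ 1) (v $ 2) - cis (- (real n * y)) * Complex (w $ 1) (w $ 2))
    \<le> (real n * \<bar>y\<bar> * M + V) * (\<bar>y\<bar> / \<theta>) powr k * norm w"
proof -
  have "real n * \<bar>\<phi> \<bar>y\<bar> - \<bar>y\<bar>\<bar> = real n * \<bar>y\<bar> * \<bar>\<phi> \<bar>y\<bar> / \<bar>y\<bar> - 1\<bar>"
  proof -
    have "\<bar>y\<bar> * \<bar>\<phi> \<bar>y\<bar> / \<bar>y\<bar> - 1\<bar> = \<bar>\<bar>y\<bar> * (\<phi> \<bar>y\<bar> / \<bar>y\<bar> - 1)\<bar>"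
      by (simp add: abs_mult)
    also have "\<bar>y\<bar> * (\<phi> \<bar>y\<bar> / \<bar>y\<bar> - 1) = \<phi> \<bar>y\<bar> - \<bar>y\<bar>"
      using y(1) by (simp add: right_diff_distrib)
    finally show ?thesis by (simp add: mult.assoc)
  qed
  also have "\<dots> \<le> real n * \<bar>y\<bar> * (M * (\<bar>y\<bar> / \<theta>) powr k)"
    using powr_rescale[OF _ \<theta>(1) M] y(1) by (intro mult_left_mono) auto
  finally have le: "real n * \<bar>\<phi> \<bar>y\<bar> - \<bar>y\<bar>\<bar> + op_norm (error_matrix \<epsilon> \<gamma> \<bar>y\<bar>)
      \<le> (real n * \<bar>y\<bar> * M + V) * (\<bar>y\<bar> / \<theta>) powr k"
    using powr_rescale[OF _ \<theta>(1) V] y(1) by (simp add: algebra_simps)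
  have "\<bar>y\<bar> < ystar" using y \<theta> by simp
  from one_frequency_error(1)[OF K this, of n w] show ?thesis
    unfolding v_def by (rule order_trans[OF _ mult_right_mono[OF le norm_ge_zero]])
qed

section \<open>The global error estimate: summation over the frequencies\<close>

theorem theorem5:
  fixes H :: "real^'n^'n"
    and a b :: "nat \<Rightarrow> real"
    and m r n :: nat
    and \<phi> \<epsilon> \<gamma> :: "real \<Rightarrow> real"
    and ystar t \<tau> \<theta> k :: real
    and q0 p0 :: "real^'n"
  assumes "H \<noteq> 0" and "transpose H = H"
    and "of_order (prop_matrix a b m) r"
    and "is_stability_threshold (prop_matrix a b m) ystar"
    and "associated_functions (prop_matrix a b m) ystar \<phi> \<epsilon> \<gamma>"
    and "t > 0" and "n \<ge> 1"
    and "\<tau> = t / real n" and "\<tau> = \<theta> / spectral_radius H" and "\<theta> < ystar"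
    and "0 \<le> k" and "k \<le> real r"
  shows "ennreal (norm (splitting_approx a b m H \<tau> n q0 p0 - exact_solution H t (cvec q0 p0)))
    \<le> (ennreal t * mu \<phi> k \<theta> * ennreal (norm_H H (k + 1) (cvec q0 p0))
        + nu \<epsilon> \<gamma> k \<theta> * ennreal (norm_H H k (cvec q0 p0)))
      / ennreal (spectral_radius H powr k)"
proof -
  obtain B lam where "eigenbasis H B lam"
    using symmetric_eigenbasis assms(2) by blast
  then interpret eigenbasis H B lam .
  define \<rho> where "\<rho> = spectral_radius H"
  define h where "h = (\<lambda>c. Complex (q0 \<bullet> c) (p0 \<bullet> c))"
  define err where "err = (\<lambda>c. (let w = mat_power (prop_matrix a b m (\<tau> * lam c)) n *v vector [q0 \<bullet> c, p0 \<bullet> c]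
               in Complex (w $ 1) (w $ 2)) - cis (- t * lam c) * h c)"
  define N1 where "N1 = norm_H H (k + 1) (cvec q0 p0)"
  define N0 where "N0 = norm_H H k (cvec q0 p0)"
  have err: "norm (splitting_approx a b m H \<tau> n q0 p0 - exact_solution H t (cvec q0 p0))
      = L2_set (\<lambda>c. cmod (err c)) B"
    unfolding splitting_approx_eq exact_solution_eq ccomb_diff norm_ccomb err_def h_def ..
  have N1: "N1 = L2_set (\<lambda>c. \<bar>lam c\<bar> powr (k + 1) * cmod (h c)) B"
    and N0: "N0 = L2_set (\<lambda>c. (if k = 0 then 1 else \<bar>lam c\<bar> powr k) * cmod (h c)) B"
    using \<open>0 \<le> k\<close> unfolding N1_def N0_def cvec_expand by (simp_all add: norm_H_ccomb h_def)
  have \<rho>: "\<rho> > 0" using spectral_radius_pos \<open>H \<noteq> 0\<close> by (simp add: \<rho>_def)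
  have \<tau>: "\<tau> > 0" "real n * \<tau> = t" using assms by auto
  have "\<theta> = \<tau> * \<rho>" using assms(9) \<rho> by (simp add: \<rho>_def)
  with \<rho> \<tau> have \<theta>: "\<theta> = \<tau> * \<rho>" "\<theta> > 0" by simp_all
  note assoc = \<open>associated_functions _ ystar \<phi> \<epsilon> \<gamma>\<close>
  have freq: "\<bar>\<tau> * lam c\<bar> \<le> \<theta>" if "c \<in> B" for c
    using abs_lam_le_spectral_radius[OF that] \<tau> by (simp add: abs_mult \<theta> \<rho>_def)
  have err_c: "cmod (err c) = (let w = vector [q0 \<bullet> c, p0 \<bullet> c];
      v = mat_power (prop_matrix a b m (\<tau> * lam c)) n *v w in
      cmod (Complex (v $ 1) (v $ 2) - cis (- (real n * (\<tau> * lam c))) * Complex (w $ 1) (w $ 2)))"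
    and h_c: "norm (vector [q0 \<bullet> c, p0 \<bullet> c] :: real^2) = cmod (h c)" for c
    using \<tau>(2) by (simp_all add: err_def Let_def h_def norm_real2 flip: mult.assoc)
  have err0: "err c = 0" if "c \<in> B" "lam c = 0 \<or> h c = 0" for c
  proof -
    \<comment> \<open>A zero eigenvalue gives \<open>y = 0\<close>; a zero coordinate kills the
      factor \<open>norm w\<close> in the bound.\<close>
    have "cmod (err c) \<le> 0"
      using that(2) one_frequency_error[OF assoc, of "\<tau> * lam c" n "vector [q0 \<bullet> c, p0 \<bullet> c]"]
        freq[OF that(1)] \<open>\<theta> < ystar\<close>
      unfolding err_c Let_def h_c by auto
    then show ?thesis by simp
  qed
  \<comment> \<open>If \<open>N0\<close> or \<open>N1\<close> vanishes, the initial vector lies in the kernel of \<open>H\<close> and the error vanishes,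
    so an infinite \<open>mu\<close> or \<open>nu\<close> multiplied by \<open>0\<close> does no harm.\<close>
  show ?thesis
  proof (cases "N0 = 0 \<or> N1 = 0")
    case True
    then have "err c = 0" if "c \<in> B" for c
      using err0[OF that] that by (auto simp: N0 N1 L2_set_eq_0_iff split: if_splits)
    then have "L2_set (\<lambda>c. cmod (err c)) B = 0" by (simp add: L2_set_eq_0_iff)
    then show ?thesis unfolding err by simp
  next
    case False
    then have N: "N0 > 0" "N1 > 0"
      using L2_set_nonneg by (auto simp: N0 N1 less_le)
    show ?thesis
    proof (cases "mu \<phi> k \<theta> = top \<or> nu \<epsilon> \<gamma> k \<theta> = top")
      case True
      \<comment> \<open>Here \<open>t\<close>, \<open>N0\<close> and \<open>N1\<close> are positive,
        so an infinite supremum makes the whole right-hand side infinite.\<close>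
      then have "ennreal t * mu \<phi> k \<theta> * ennreal N1 + nu \<epsilon> \<gamma> k \<theta> * ennreal N0 = top"
        using N \<open>t > 0\<close> by (auto simp: ennreal_mult_top ennreal_top_mult ennreal_mult_eq_top_iff)
      then show ?thesis
        unfolding N0_def[symmetric] N1_def[symmetric] by (simp only: ennreal_top_divide) simp
    next
      case False
      then obtain M V where MV: "mu \<phi> k \<theta> = ennreal M" "nu \<epsilon> \<gamma> k \<theta> = ennreal V" "M \<ge> 0" "V \<ge> 0"
        by (metis ennreal_cases)
      have M: "\<bar>\<phi> y / y - 1\<bar> * (\<theta> / y) powr k \<le> M" and V: "op_norm (error_matrix \<epsilon> \<gamma> y) * (\<theta> / y) powr k \<le> V"
        if "0 < y" "y \<le> \<theta>" for y
        using that MV SUP_upper[of y "{0<..\<theta>}" "\<lambda>y. ennreal (\<bar>\<phi> y / y - 1\<bar> * (\<theta> / y) powr k)"]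
          SUP_upper[of y "{0<..\<theta>}" "\<lambda>y. ennreal (op_norm (error_matrix \<epsilon> \<gamma> y) * (\<theta> / y) powr k)"]
        by (auto simp: mu_def nu_def)
      \<comment> \<open>The accumulated phase contributes \<open>n |y| = t |lam c|\<close>; this
        extra factor raises the exponent in \<open>?F\<close> to \<open>k + 1\<close>, while
        \<open>?G\<close> keeps \<open>k\<close>.\<close>
      let ?F = "\<lambda>c. t * M / \<rho> powr k * (\<bar>lam c\<bar> powr (k + 1) * cmod (h c))"
      let ?G = "\<lambda>c. V / \<rho> powr k * ((if k = 0 then 1 else \<bar>lam c\<bar> powr k) * cmod (h c))"
      have "cmod (err c) \<le> ?F c + ?G c" if "c \<in> B" for c
      \<comment> \<open>The suprema say nothing about \<open>y = 0\<close>, but there the error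
        vanishes and the right-hand side is nonnegative.\<close>
      proof (cases "lam c = 0")
        case True
        then show ?thesis using err0[OF that] MV \<rho> by simp
      next
        case False
        have y: "\<tau> * lam c \<noteq> 0" using False \<tau> by simp
        then have "cmod (err c) \<le> (real n * \<bar>\<tau> * lam c\<bar> * M + V) * (\<bar>\<tau> * lam c\<bar> / \<theta>) powr k * cmod (h c)"
          unfolding err_c Let_def h_c[symmetric] using freq[OF that] M V
          by (intro one_frequency_error_powr[OF assoc \<theta>(2) \<open>\<theta> < ystar\<close>]) auto
        also have "real n * \<bar>\<tau> * lam c\<bar> = t * \<bar>lam c\<bar>"
          using \<tau> by (simp add: abs_mult flip: mult.assoc)
        also have "\<bar>\<tau> * lam c\<bar> / \<theta> = \<bar>lam c\<bar> / \<rho>"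
          using \<tau> by (simp add: \<theta>(1) abs_mult)
        also have "(t * \<bar>lam c\<bar> * M + V) * (\<bar>lam c\<bar> / \<rho>) powr k * cmod (h c) = ?F c + ?G c"
          using False \<rho> by (simp add: powr_divide powr_add add_divide_distrib algebra_simps)
        finally show ?thesis .
      qed
      then have "L2_set (\<lambda>c. cmod (err c)) B \<le> L2_set (\<lambda>c. ?F c + ?G c) B"
        by (intro L2_set_mono) auto
      also have "\<dots> \<le> L2_set ?F B + L2_set ?G B"
        by (rule L2_set_triangle_ineq)
      also have "\<dots> = t * M / \<rho> powr k * N1 + V / \<rho> powr k * N0"
        unfolding N1 N0 using MV \<open>t > 0\<close> by (subst (1 2) L2_set_right_distrib) auto
      also have "\<dots> = (t * M * N1 + V * N0) / \<rho> powr k"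
        by (simp add: add_divide_distrib)
      finally have "L2_set (\<lambda>c. cmod (err c)) B \<le> (t * M * N1 + V * N0) / \<rho> powr k" .
      moreover have "ennreal ((t * M * N1 + V * N0) / \<rho> powr k) =
          (ennreal t * ennreal M * ennreal N1 + ennreal V * ennreal N0) / ennreal (\<rho> powr k)"
        using MV N \<open>t > 0\<close> \<rho> by (simp add: ennreal_mult ennreal_plus flip: divide_ennreal)
      ultimately show ?thesis
        unfolding err MV N0_def[symmetric] N1_def[symmetric] \<rho>_def[symmetric]
        by (metis ennreal_leI)
    qed
  qed
qed

end
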